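(* Let $X$ be a random input with values in $\mathcal X$ and $Y$ a random target. Let $\varphi_1,\dots,\varphi_K:\mathcal X\to\mathcal V$ be a family of views carrying $X$ into a common presentation space $\mathcal V$. Let $\sim$ be the equivalence relation on $\mathcal V$ generated by $\varphi_v(x)\sim\varphi_w(x)$ for all $x\in\mathcal X$ and all $v,w$, let $q:\mathcal V\to\mathcal V/\!\sim$ be the quotient map, and let $Q:=q(\varphi_1(X))$, which equals $q(\varphi_v(X))$ for every $v$. For each $v$ put $R(\varphi_v):=H(Y\mid\varphi_v(X))$, the best risk from view $v$ alone. Let $R_{\mathrm{inv}}$ be the best log loss achievable by an orbit-constant predictor. Then $R_{\mathrm{inv}}=H(Y\mid Q)$ and $$R_{\mathrm{inv}}\ \ge\ \max_{v}R(\varphi_v),\qquad\text{so}\qquad R_{\mathrm{inv}}-\min_{v}R(\varphi_v)\ \ge\ \delta:=\max_{v}R(\varphi_v)-\min_{v}R(\varphi_v).$$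
   Context: A predictor $f$ on $\mathcal V$ receives a single presentation $p\in\mathcal V$, equal to $\varphi_v(X)$ for some $v$, and is not told which $v$ produced it; it outputs a predictive distribution $f(\cdot\mid p)$ for $Y$. It is orbit-constant if $f(\varphi_v(x))=f(\varphi_w(x))$ for all $x,v,w$, that is, if it is measurable with respect to the quotient of $\mathcal V$ by $\sim$ (equivalently $f=\tilde f\circ q$ for some $\tilde f$ on $\mathcal V/\!\sim$). The log loss of an orbit-constant predictor is $\mathbb E[-\log f(Y\mid\varphi_v(X))]$, which does not depend on $v$, and $R_{\mathrm{inv}}$ is the infimum of this quantity over orbit-constant predictors. $H(Y\mid W)$ denotes the conditional entropy of $Y$ given $W$, i.e. the expected log loss $\mathbb E[-\log p(Y\mid W)]$ of the conditional law $p(\cdot\mid W)$ of $Y$ given $W$. The views and the quotient map are taken to be measurable, so that $Q$ is a measurable function of $\varphi_v(X)$ for every $v$. *)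

theory Defs
  imports "HOL-Probability.Probability"
begin

section \<open>Log loss and conditional entropy of a discrete target\<close>

text \<open>
  The target takes values in a countable type with the discrete \<open>\<sigma>\<close>-algebra, so that predictive
  distributions and conditional laws are given by probability mass functions. Logarithms are
  natural, and losses are extended nonnegative reals since \<open>- log 0 = \<infinity>\<close> and entropies of targets
  with infinitely many values may be infinite.
\<close>

definition neg_log :: "real \<Rightarrow> ennreal" where
  "neg_log t = (if 0 < t then ennreal (- ln t) else \<infinity>)"

definition predictor :: "'v measure \<Rightarrow> ('v \<Rightarrow> 'y::countable pmf) \<Rightarrow> bool" where
  "predictor V f \<longleftrightarrow> (\<lambda>p. measure_pmf (f p)) \<in> V \<rightarrow>\<^sub>M prob_algebra (count_space UNIV)"

definition log_loss ::
    "'a measure \<Rightarrow> ('a \<Rightarrow> 'v) \<Rightarrow> ('a \<Rightarrow> 'y::countable) \<Rightarrow> ('v \<Rightarrow> 'y pmf) \<Rightarrow> ennreal" where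
  "log_loss M W Y f = (\<integral>\<^sup>+ \<omega>. neg_log (pmf (f (W \<omega>)) (Y \<omega>)) \<partial>M)"

text \<open>
  The probability mass at \<open>y\<close> of the conditional law of \<open>Y\<close> given \<open>W\<close>, where \<open>W\<close> takes values in the
  measurable space \<open>N\<close>: the conditional probability of \<open>Y = y\<close> given the \<open>\<sigma>\<close>-algebra generated
  by \<open>W\<close>. It is determined up to a null set for each of the countably many \<open>y\<close>, so the entropy
  below does not depend on the version chosen by \<^const>\<open>real_cond_exp\<close>.
\<close>

definition cond_prob_mass ::
    "'a measure \<Rightarrow> 'w measure \<Rightarrow> ('a \<Rightarrow> 'w) \<Rightarrow> ('a \<Rightarrow> 'y::countable) \<Rightarrow> 'y \<Rightarrow> 'a \<Rightarrow> real" where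
  "cond_prob_mass M N W Y y =
     real_cond_exp M (vimage_algebra (space M) W N) (indicator {\<omega> \<in> space M. Y \<omega> = y})"

definition cond_entropy ::
    "'a measure \<Rightarrow> 'w measure \<Rightarrow> ('a \<Rightarrow> 'w) \<Rightarrow> ('a \<Rightarrow> 'y::countable) \<Rightarrow> ennreal" where
  "cond_entropy M N W Y = (\<integral>\<^sup>+ \<omega>. neg_log (cond_prob_mass M N W Y (Y \<omega>) \<omega>) \<partial>M)"

section \<open>The quotient of a measurable space\<close>

definition equiv_generated :: "'v set \<Rightarrow> ('v \<times> 'v) set \<Rightarrow> ('v \<times> 'v) set" where
  "equiv_generated A g = \<Inter> {r. equiv A r \<and> g \<subseteq> r}"

definition quot_map :: "('v \<times> 'v) set \<Rightarrow> 'v \<Rightarrow> 'v set" where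
  "quot_map r p = r `` {p}"

text \<open>
  The quotient carries the largest \<open>\<sigma>\<close>-algebra that makes the quotient map measurable. With it,
  the measurable functions on \<open>V\<close> that are constant on classes are exactly the measurable
  functions of the quotient map, see \<open>orbit_constant_iff_factors\<close> below.
\<close>

definition quot_space :: "'v measure \<Rightarrow> ('v \<times> 'v) set \<Rightarrow> 'v set measure" where
  "quot_space V r =
     sigma (space V // r) {B. B \<subseteq> space V // r \<and> quot_map r -` B \<inter> space V \<in> sets V}"

section \<open>Views\<close>

definition view_rel ::
    "'x measure \<Rightarrow> 'v measure \<Rightarrow> nat \<Rightarrow> (nat \<Rightarrow> 'x \<Rightarrow> 'v) \<Rightarrow> ('v \<times> 'v) set" where
  "view_rel S V K \<phi> = equiv_generated (space V)
     {(\<phi> v x, \<phi> w x) | v w x. v \<in> {1..K} \<and> w \<in> {1..K} \<and> x \<in> space S}"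

definition orbit_constant ::
    "'x measure \<Rightarrow> nat \<Rightarrow> (nat \<Rightarrow> 'x \<Rightarrow> 'v) \<Rightarrow> ('v \<Rightarrow> 'b) \<Rightarrow> bool" where
  "orbit_constant S K \<phi> f \<longleftrightarrow>
     (\<forall>x\<in>space S. \<forall>v\<in>{1..K}. \<forall>w\<in>{1..K}. f (\<phi> v x) = f (\<phi> w x))"

definition view_risk ::
    "'a measure \<Rightarrow> 'v measure \<Rightarrow> (nat \<Rightarrow> 'x \<Rightarrow> 'v) \<Rightarrow> ('a \<Rightarrow> 'x) \<Rightarrow> ('a \<Rightarrow> 'y::countable) \<Rightarrow> nat \<Rightarrow> ennreal"
  where
  "view_risk M V \<phi> X Y v = cond_entropy M V (\<lambda>\<omega>. \<phi> v (X \<omega>)) Y"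

text \<open>The choice of view 1 in the loss is immaterial, see \<open>log_loss_orbit_constant\<close> below.\<close>

definition inv_risk ::
    "'a measure \<Rightarrow> 'x measure \<Rightarrow> 'v measure \<Rightarrow> nat \<Rightarrow> (nat \<Rightarrow> 'x \<Rightarrow> 'v) \<Rightarrow>
     ('a \<Rightarrow> 'x) \<Rightarrow> ('a \<Rightarrow> 'y::countable) \<Rightarrow> ennreal" where
  "inv_risk M S V K \<phi> X Y =
     (INF f \<in> {f. predictor V f \<and> orbit_constant S K \<phi> f}. log_loss M (\<lambda>\<omega>. \<phi> 1 (X \<omega>)) Y f)"

section \<open>Sanity checks\<close>

lemma log_loss_orbit_constant:
  assumes "X \<in> M \<rightarrow>\<^sub>M S" "orbit_constant S K \<phi> f" "v \<in> {1..K}" "w \<in> {1..K}"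
  shows "log_loss M (\<lambda>\<omega>. \<phi> v (X \<omega>)) Y f = log_loss M (\<lambda>\<omega>. \<phi> w (X \<omega>)) Y f"
  unfolding log_loss_def
proof (rule nn_integral_cong)
  fix \<omega> assume "\<omega> \<in> space M"
  then have "X \<omega> \<in> space S" by (rule measurable_space[OF assms(1)])
  then have "f (\<phi> v (X \<omega>)) = f (\<phi> w (X \<omega>))"
    using assms(2-4) unfolding orbit_constant_def by blast
  then show "neg_log (pmf (f (\<phi> v (X \<omega>))) (Y \<omega>)) = neg_log (pmf (f (\<phi> w (X \<omega>))) (Y \<omega>))"
    by simp
qed

lemma equiv_equiv_generated:
  assumes "g \<subseteq> A \<times> A"
  shows "equiv A (equiv_generated A g)"
proof -
  have "equiv A (A \<times> A)"
    by (auto simp: equiv_def refl_on_def sym_def trans_def)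
  with assms have "equiv_generated A g \<subseteq> A \<times> A"
    unfolding equiv_generated_def by blast
  moreover have "refl_on A (equiv_generated A g)"
    by (auto simp: equiv_generated_def refl_on_def equiv_def)
  moreover have "sym (equiv_generated A g)"
    by (auto simp: equiv_generated_def equiv_def intro!: symI dest: symD)
  moreover have "trans (equiv_generated A g)"
    by (rule transI) (simp add: equiv_generated_def equiv_def, meson transD)
  ultimately show ?thesis by (simp add: equiv_def)
qed

lemma equiv_view_rel:
  assumes "\<And>v. v \<in> {1..K} \<Longrightarrow> \<phi> v \<in> S \<rightarrow>\<^sub>M V"
  shows "equiv (space V) (view_rel S V K \<phi>)"
  unfolding view_rel_def
  by (rule equiv_equiv_generated) (use assms in \<open>auto dest: measurable_space\<close>)

lemma space_quot_space [simp]: "space (quot_space V r) = space V // r"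
  unfolding quot_space_def by (rule space_measure_of) auto

lemma sets_quot_space:
  assumes "equiv (space V) r"
  shows "sets (quot_space V r) =
    {B. B \<subseteq> space V // r \<and> quot_map r -` B \<inter> space V \<in> sets V}" (is "_ = ?G")
proof -
  have into: "quot_map r p \<in> space V // r" if "p \<in> space V" for p
    using that by (simp add: quot_map_def quotientI)
  have "sigma_algebra (space V // r) ?G"
    unfolding sigma_algebra_iff2
  proof (intro conjI ballI allI impI)
    show "?G \<subseteq> Pow (space V // r)" by auto
    show "{} \<in> ?G" by simp
  next
    fix B assume B: "B \<in> ?G"
    have "quot_map r -` (space V // r - B) \<inter> space V = space V - (quot_map r -` B \<inter> space V)"
      using into by auto
    with B show "space V // r - B \<in> ?G" by auto
  next
    fix B :: "nat \<Rightarrow> _" assume B: "range B \<subseteq> ?G"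
    have "quot_map r -` (\<Union>i. B i) \<inter> space V = (\<Union>i. quot_map r -` B i \<inter> space V)" by auto
    also have "\<dots> \<in> sets V" using B by (intro sets.countable_UN) auto
    finally show "(\<Union>i. B i) \<in> ?G" using B by auto
  qed
  then have "sigma_sets (space V // r) ?G = ?G"
    by (rule sigma_algebra.sigma_sets_eq)
  moreover have "sets (quot_space V r) = sigma_sets (space V // r) ?G"
    unfolding quot_space_def by (rule sets_measure_of) auto
  ultimately show ?thesis by (rule trans[rotated])
qed

lemma measurable_quot_map:
  assumes "equiv (space V) r"
  shows "quot_map r \<in> V \<rightarrow>\<^sub>M quot_space V r"
  by (rule measurableI) (auto simp: sets_quot_space[OF assms] quot_map_def quotientI)

lemma quot_map_view_eq:
  assumes "\<And>v. v \<in> {1..K} \<Longrightarrow> \<phi> v \<in> S \<rightarrow>\<^sub>M V"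
    and "x \<in> space S" "v \<in> {1..K}" "w \<in> {1..K}"
  shows "quot_map (view_rel S V K \<phi>) (\<phi> v x) = quot_map (view_rel S V K \<phi>) (\<phi> w x)"
proof -
  have "(\<phi> v x, \<phi> w x) \<in> view_rel S V K \<phi>"
    unfolding view_rel_def equiv_generated_def using assms(2-4) by blast
  with equiv_view_rel[of K \<phi> S V, OF assms(1)] show ?thesis
    unfolding quot_map_def by (rule equiv_class_eq)
qed

lemma orbit_constant_iff_factors:
  assumes \<phi>: "\<And>v. v \<in> {1..K} \<Longrightarrow> \<phi> v \<in> S \<rightarrow>\<^sub>M V"
    and f: "f \<in> V \<rightarrow>\<^sub>M N"
  defines "r \<equiv> view_rel S V K \<phi>"
  shows "orbit_constant S K \<phi> f \<longleftrightarrow>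
    (\<exists>g \<in> quot_space V r \<rightarrow>\<^sub>M N. \<forall>p\<in>space V. f p = g (quot_map r p))" (is "?L = ?R")
proof
  assume ?R
  then obtain g where g: "\<And>p. p \<in> space V \<Longrightarrow> f p = g (quot_map r p)" by blast
  show ?L unfolding orbit_constant_def
  proof (intro ballI)
    fix x v w assume *: "x \<in> space S" "v \<in> {1..K}" "w \<in> {1..K}"
    then have "\<phi> v x \<in> space V" "\<phi> w x \<in> space V" using \<phi> measurable_space by metis+
    with quot_map_view_eq[of K \<phi> S V, OF \<phi> *] g show "f (\<phi> v x) = f (\<phi> w x)"
      unfolding r_def by simp
  qed
next
  assume L: ?L
  have r: "equiv (space V) r" unfolding r_def using \<phi> by (rule equiv_view_rel)
  let ?E = "{(p, p'). p \<in> space V \<and> p' \<in> space V \<and> f p = f p'}"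
  have "equiv (space V) ?E" by (auto simp: equiv_def refl_on_def sym_def trans_def)
  moreover have "{(\<phi> v x, \<phi> w x) | v w x. v \<in> {1..K} \<and> w \<in> {1..K} \<and> x \<in> space S} \<subseteq> ?E"
    using L measurable_space[OF \<phi>] unfolding orbit_constant_def by blast
  ultimately have rE: "r \<subseteq> ?E"
    unfolding r_def view_rel_def equiv_generated_def by (intro Inter_lower) simp
  define g where "g B = f (SOME p. p \<in> B)" for B
  have fg: "f p = g (quot_map r p)" if "p \<in> space V" for p
  proof -
    have "p \<in> quot_map r p" unfolding quot_map_def using r that by (rule equiv_class_self)
    then have "(SOME p'. p' \<in> quot_map r p) \<in> quot_map r p" by (rule someI)
    with rE show ?thesis by (auto simp: quot_map_def g_def)
  qed
  have sur: "\<exists>p\<in>space V. B = quot_map r p" if "B \<in> space V // r" for B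
    using that unfolding quot_map_def by (rule quotientE) blast
  have into: "quot_map r p \<in> space V // r" if "p \<in> space V" for p
    using that by (simp add: quot_map_def quotientI)
  have "g \<in> quot_space V r \<rightarrow>\<^sub>M N"
  proof (rule measurableI)
    fix B assume "B \<in> space (quot_space V r)"
    with sur obtain p where "p \<in> space V" "B = quot_map r p" by auto
    then show "g B \<in> space N" using fg f by (metis measurable_space)
  next
    fix A assume A: "A \<in> sets N"
    have "quot_map r -` (g -` A \<inter> space V // r) \<inter> space V = f -` A \<inter> space V"
      using into fg by auto
    with measurable_sets[OF f A] show "g -` A \<inter> space (quot_space V r) \<in> sets (quot_space V r)"
      by (simp add: sets_quot_space[OF r])
  qed
  with fg show ?R by blast
qed

end

theory Submission
  imports Defs
begin

text \<open>
  By Gibbs' inequality the conditional entropy of the target given an observation \<open>W\<close> bounds the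
  log loss of every predictor that reads \<open>W\<close>, and the conditional law of the target, which is a
  measurable function of \<open>W\<close>, attains this bound. Orbit-constant predictors are the predictors that
  read \<open>Q\<close>, so their best log loss is \<open>H(Y | Q)\<close>. Since \<open>Q\<close> is a measurable function of each
  single view, every predictor that reads \<open>Q\<close> can be run on that view alone with the same loss.
\<close>

section \<open>Pointwise Gibbs inequality and measurability tools for a countable target\<close>

lemma measurable_neg_log [measurable]: "neg_log \<in> borel_measurable borel"
  unfolding neg_log_def by measurable

text \<open>This is \<open>ln t \<le> t - 1\<close> at \<open>t = r / p\<close>, multiplied by
  \<open>p\<close>. The terms \<open>p\<close> and \<open>r\<close> stand on opposite sides so that
  nothing is subtracted in \<open>ennreal\<close>. The boundary cases rest on
  \<open>0 * \<infinity> = 0\<close> when \<open>p = 0\<close> and on an infinite right-hand side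
  when \<open>r = 0 < p\<close>.\<close>

lemma neg_log_cross_term:
  fixes p r :: real
  assumes "0 \<le> p" "p \<le> 1" "0 \<le> r" "r \<le> 1"
  shows "ennreal p * neg_log p + ennreal p \<le> ennreal p * neg_log r + ennreal r"
proof -
  consider "p = 0" | "0 < p" "r = 0" | "0 < p" "0 < r"
    using assms by fastforce
  then show ?thesis
  proof cases
    case 1
    then show ?thesis by simp
  next
    case 2
    then show ?thesis by (simp add: neg_log_def ennreal_mult_top)
  next
    case 3
    have "ln (r / p) \<le> r / p - 1"
      using 3 by (intro ln_le_minus_one) simp
    then have "p * (ln r - ln p) \<le> p * (r / p - 1)"
      using 3 by (intro mult_left_mono) (auto simp: ln_div)
    then have "p * (- ln p) + p \<le> p * (- ln r) + r"
      using 3 by (simp add: algebra_simps)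
    moreover have "0 \<le> - ln p" "0 \<le> - ln r"
      using 3 assms by auto
    moreover have "0 \<le> p * (- ln p)" "0 \<le> p * (- ln r)"
      using 3 assms by (auto simp: mult_le_0_iff)
    ultimately show ?thesis
      using 3 unfolding neg_log_def
      by (simp del: mult_minus_right flip: ennreal_mult ennreal_plus)
  qed
qed

text \<open>The sets of the generated algebra are preimages under \<open>W\<close>, which settles
  indicators, and the factorization survives scaling, sums and suprema. With values in
  \<open>ennreal\<close> the supremum of the factors exists everywhere on \<open>N\<close>, even off
  the range of \<open>W\<close>, where they may fail to be monotone.\<close>

lemma Doob_Dynkin_ennreal:
  fixes f :: "'a \<Rightarrow> ennreal"
  assumes W: "W \<in> A \<rightarrow> space N" and f: "f \<in> borel_measurable (vimage_algebra A W N)"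
  shows "\<exists>h\<in>borel_measurable N. \<forall>x\<in>A. f x = h (W x)"
  using f
proof (induction rule: borel_measurable_induct)
  case (cong f g)
  then show ?case by simp
next
  case (set B)
  then obtain D where "D \<in> sets N" "B = W -` D \<inter> A"
    using sets_vimage_algebra2[OF W] by auto
  then show ?case
    by (intro bexI[of _ "indicator D"]) (auto split: split_indicator)
next
  case (mult u c)
  then obtain h where "h \<in> borel_measurable N" "\<forall>x\<in>A. u x = h (W x)" by blast
  then show ?case by (intro bexI[of _ "\<lambda>x. c * h x"]) auto
next
  case (add u v)
  then obtain h k where "h \<in> borel_measurable N" "\<forall>x\<in>A. u x = h (W x)"
    "k \<in> borel_measurable N" "\<forall>x\<in>A. v x = k (W x)" by blast
  then show ?case by (intro bexI[of _ "\<lambda>x. k x + h x"]) auto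
next
  case (seq U)
  then obtain h where "\<And>i. h i \<in> borel_measurable N" "\<And>i x. x \<in> A \<Longrightarrow> U i x = h i (W x)"
    by metis
  then show ?case
    by (intro bexI[of _ "\<lambda>x. SUP i. h i x"]) (auto simp: image_comp)
qed

text \<open>For a countable discrete second coordinate, measurability of each section gives joint
  measurability, and \<open>count_space UNIV\<close> is sigma-finite, so the partial integral is
  measurable.\<close>

lemma measurable_nn_integral_count_space:
  fixes f :: "'y::countable \<Rightarrow> 'a \<Rightarrow> ennreal"
  assumes [measurable]: "\<And>y. f y \<in> borel_measurable M"
  shows "(\<lambda>x. \<integral>\<^sup>+y. f y x \<partial>count_space UNIV) \<in> borel_measurable M"
proof -
  interpret sigma_finite_measure "count_space (UNIV :: 'y set)"
    by (rule sigma_finite_measure_count_space)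
  have "(\<lambda>(x, y). f y x) \<in> borel_measurable (M \<Otimes>\<^sub>M count_space UNIV)"
    by (subst measurable_split_conv)
      (rule measurable_compose_countable'[where I = UNIV and g = snd], auto)
  then show ?thesis by (rule borel_measurable_nn_integral)
qed

text \<open>The probability of any event is the sum of its point masses, so measurability of the
  countably many masses controls the whole predictive distribution.\<close>

lemma predictor_iff_pmf:
  "predictor V f \<longleftrightarrow> (\<forall>y. (\<lambda>p. pmf (f p) y) \<in> borel_measurable V)"
proof
  assume "predictor V f"
  then have "(\<lambda>p. measure_pmf (f p)) \<in> V \<rightarrow>\<^sub>M subprob_algebra (count_space UNIV)"
    unfolding predictor_def by (rule measurable_prob_algebraD)
  then show "\<forall>y. (\<lambda>p. pmf (f p) y) \<in> borel_measurable V"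
    unfolding pmf.rep_eq
    by (auto intro: measurable_compose[OF _ measurable_measure_subprob_algebra])
next
  assume "\<forall>y. (\<lambda>p. pmf (f p) y) \<in> borel_measurable V"
  then have [measurable]: "(\<lambda>p. pmf (f p) y) \<in> borel_measurable V" for y by simp
  show "predictor V f" unfolding predictor_def
  proof (intro measurable_prob_algebraI measurable_subprob_algebra)
    fix A :: "'b set"
    have "emeasure (f p) A = (\<integral>\<^sup>+y. ennreal (pmf (f p) y) * indicator A y \<partial>count_space UNIV)" for p
      by (simp add: measure_pmf_eq_density emeasure_density)
    moreover have "(\<lambda>p. \<integral>\<^sup>+y. ennreal (pmf (f p) y) * indicator A y \<partial>count_space UNIV)
        \<in> borel_measurable V"
      by (rule measurable_nn_integral_count_space) measurable
    ultimately show "(\<lambda>p. emeasure (f p) A) \<in> borel_measurable V" by simp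
  qed (auto simp: prob_space_measure_pmf prob_space_imp_subprob_space)
qed

lemma predictor_compose:
  assumes "g \<in> V \<rightarrow>\<^sub>M N" "predictor N f"
  shows "predictor V (\<lambda>p. f (g p))"
  using assms unfolding predictor_def by (rule measurable_compose)

section \<open>The conditional law of the target given an observation\<close>

locale observed_target = prob_space M
  for M :: "'a measure" +
  fixes N :: "'w measure" and W :: "'a \<Rightarrow> 'w" and Y :: "'a \<Rightarrow> 'y::countable"
  assumes W [measurable]: "W \<in> M \<rightarrow>\<^sub>M N"
    and Y [measurable]: "Y \<in> M \<rightarrow>\<^sub>M count_space UNIV"
begin

definition obs_algebra :: "'a measure" where
  "obs_algebra = vimage_algebra (space M) W N"

text \<open>The \<open>ennreal\<close> counterpart of \<open>cond_prob_mass\<close>: the identity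
  characterizing \<open>nn_cond_exp\<close> holds against every nonnegative function measurable in
  the observed algebra, so infinite losses can be integrated without integrability side
  conditions.\<close>

definition cond_mass :: "'y \<Rightarrow> 'a \<Rightarrow> ennreal" where
  "cond_mass y = nn_cond_exp M obs_algebra (indicator {\<omega> \<in> space M. Y \<omega> = y})"

lemma W_space: "W \<in> space M \<rightarrow> space N"
  by (rule measurable_space[OF W, THEN funcsetI])

lemma subalgebra_obs: "subalgebra M obs_algebra"
  unfolding subalgebra_def obs_algebra_def using measurable_iff_sets[of W M N] W by simp

sublocale finite_measure_subalgebra M obs_algebra
  by unfold_locales (rule subalgebra_obs)

lemma measurable_cond_mass_obs [measurable]: "cond_mass y \<in> borel_measurable obs_algebra"
  unfolding cond_mass_def by (rule borel_measurable_nn_cond_exp)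

lemma measurable_cond_mass [measurable]: "cond_mass y \<in> borel_measurable M"
  unfolding cond_mass_def by (rule borel_measurable_nn_cond_exp2)

lemma measurable_W_obs [measurable]: "W \<in> obs_algebra \<rightarrow>\<^sub>M N"
  unfolding obs_algebra_def by (rule measurable_vimage_algebra1[OF W_space])

text \<open>Split according to the value of \<open>Y\<close>. Because \<open>G y\<close> is
  measurable in the observed algebra, the indicator of \<open>Y = y\<close> may be replaced by its
  conditional expectation under the integral. Losses, total masses and integrals over observed
  events are all computed in this way.\<close>

lemma nn_integral_target:
  assumes G [measurable]: "\<And>y. G y \<in> borel_measurable obs_algebra"
  shows "(\<integral>\<^sup>+\<omega>. G (Y \<omega>) \<omega> \<partial>M) = (\<integral>\<^sup>+y. \<integral>\<^sup>+\<omega>. G y \<omega> * cond_mass y \<omega> \<partial>M \<partial>count_space UNIV)"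
proof -
  have [measurable]: "G y \<in> borel_measurable M" for y
    using G measurable_from_subalg[OF subalgebra_obs] by blast
  let ?I = "\<lambda>y. indicator {\<omega> \<in> space M. Y \<omega> = y} :: 'a \<Rightarrow> ennreal"
  have "(\<integral>\<^sup>+\<omega>. G (Y \<omega>) \<omega> \<partial>M) = (\<integral>\<^sup>+\<omega>. \<integral>\<^sup>+y. G y \<omega> * ?I y \<omega> \<partial>count_space UNIV \<partial>M)"
  proof (rule nn_integral_cong)
    fix \<omega> assume "\<omega> \<in> space M"
    then have "(\<integral>\<^sup>+y. G y \<omega> * ?I y \<omega> \<partial>count_space UNIV)
        = (\<integral>\<^sup>+y. G y \<omega> * indicator {Y \<omega>} y \<partial>count_space UNIV)"
      by (intro nn_integral_cong) (auto split: split_indicator)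
    then show "G (Y \<omega>) \<omega> = (\<integral>\<^sup>+y. G y \<omega> * ?I y \<omega> \<partial>count_space UNIV)"
      by (simp add: nn_integral_indicator_singleton')
  qed
  also have "\<dots> = (\<integral>\<^sup>+y. \<integral>\<^sup>+\<omega>. G y \<omega> * ?I y \<omega> \<partial>M \<partial>count_space UNIV)"
    by (rule nn_integral_count_space_nn_integral) auto
  also have "\<dots> = (\<integral>\<^sup>+y. \<integral>\<^sup>+\<omega>. G y \<omega> * cond_mass y \<omega> \<partial>M \<partial>count_space UNIV)"
    unfolding cond_mass_def by (intro nn_integral_cong nn_cond_exp_intg[symmetric]) auto
  finally show ?thesis .
qed

text \<open>The sum has the same integral as the constant 1 over every observed event
  \<open>A\<close>, by \<open>nn_integral_target\<close> with \<open>G y = indicator A\<close>;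
  hence it is a version of the conditional expectation of 1.\<close>

lemma AE_sum_cond_mass: "AE \<omega> in M. (\<integral>\<^sup>+y. cond_mass y \<omega> \<partial>count_space UNIV) = 1"
proof -
  have "AE \<omega> in M. (\<integral>\<^sup>+y. cond_mass y \<omega> \<partial>count_space UNIV) = nn_cond_exp M obs_algebra (\<lambda>_. 1) \<omega>"
  proof (rule nn_cond_exp_charact)
    fix A assume A [measurable]: "A \<in> sets obs_algebra"
    have [measurable]: "A \<in> sets M" using A subalgebra_obs by (auto simp: subalgebra_def)
    have "(\<integral>\<^sup>+\<omega>\<in>A. 1 \<partial>M) = (\<integral>\<^sup>+y. \<integral>\<^sup>+\<omega>. indicator A \<omega> * cond_mass y \<omega> \<partial>M \<partial>count_space UNIV)"
      using nn_integral_target[of "\<lambda>_. indicator A"] by simp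
    also have "\<dots> = (\<integral>\<^sup>+\<omega>. \<integral>\<^sup>+y. indicator A \<omega> * cond_mass y \<omega> \<partial>count_space UNIV \<partial>M)"
      by (rule nn_integral_count_space_nn_integral[symmetric]) auto
    also have "\<dots> = (\<integral>\<^sup>+\<omega>\<in>A. (\<integral>\<^sup>+y. cond_mass y \<omega> \<partial>count_space UNIV) \<partial>M)"
      by (simp add: nn_integral_cmult mult.commute)
    finally show "(\<integral>\<^sup>+\<omega>\<in>A. 1 \<partial>M) = (\<integral>\<^sup>+\<omega>\<in>A. (\<integral>\<^sup>+y. cond_mass y \<omega> \<partial>count_space UNIV) \<partial>M)" .
  next
    show "(\<lambda>\<omega>. \<integral>\<^sup>+y. cond_mass y \<omega> \<partial>count_space UNIV) \<in> borel_measurable obs_algebra"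
      by (rule measurable_nn_integral_count_space) measurable
  qed auto
  moreover have "AE \<omega> in M. 1 = nn_cond_exp M obs_algebra (\<lambda>_. 1) \<omega>"
    by (rule nn_cond_exp_F_meas) simp
  ultimately show ?thesis by eventually_elim simp
qed

lemma cond_mass_le_1:
  assumes "(\<integral>\<^sup>+y. cond_mass y \<omega> \<partial>count_space UNIV) = 1"
  shows "cond_mass y \<omega> \<le> 1"
  using nn_integral_ge_point[of y UNIV "\<lambda>y. cond_mass y \<omega>"] assms by simp

text \<open>An indicator has zero negative part, so its real conditional expectation is the
  nonnegative one. Countability merges the null sets of all \<open>y\<close> into one, which permits
  the later substitution of the random value \<open>Y \<omega>\<close> for \<open>y\<close>.\<close>

lemma AE_cond_prob_mass:
  "AE \<omega> in M. \<forall>y. cond_prob_mass M N W Y y \<omega> = enn2real (cond_mass y \<omega>)"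
proof -
  have "AE \<omega> in M. cond_prob_mass M N W Y y \<omega> = enn2real (cond_mass y \<omega>)" for y
  proof -
    have *: "ennreal (- indicator B x) = 0" "ennreal (indicator B x) = indicator B x" for B and x :: 'a
      by (auto split: split_indicator simp: ennreal_neg)
    have "AE \<omega> in M. 0 = nn_cond_exp M obs_algebra (\<lambda>_. 0) \<omega>"
      by (rule nn_cond_exp_F_meas) simp
    then show ?thesis
      unfolding cond_prob_mass_def real_cond_exp_def cond_mass_def obs_algebra_def[symmetric] *
      by eventually_elim simp
  qed
  then show ?thesis by (simp add: AE_all_countable)
qed

section \<open>Conditional entropy as the least log loss\<close>

lemma cond_entropy_eq:
  "cond_entropy M N W Y = (\<integral>\<^sup>+\<omega>. neg_log (enn2real (cond_mass (Y \<omega>) \<omega>)) \<partial>M)"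
  unfolding cond_entropy_def
  by (rule nn_integral_cong_AE) (use AE_cond_prob_mass in eventually_elim, simp)

text \<open>
  Adding the total mass 1 to both sides makes Gibbs' inequality hold term by term, also when
  some of the integrals are infinite.
\<close>

lemma cond_entropy_le_log_loss:
  assumes "predictor N f"
  shows "cond_entropy M N W Y \<le> log_loss M W Y f"
proof -
  define g where "g y \<omega> = pmf (f (W \<omega>)) y" for y \<omega>
  have gF [measurable]: "g y \<in> borel_measurable obs_algebra" for y
    using assms unfolding predictor_iff_pmf g_def
    by (auto intro: measurable_compose[OF measurable_W_obs])
  then have [measurable]: "g y \<in> borel_measurable M" for y
    using measurable_from_subalg[OF subalgebra_obs] by blast
  let ?L = "\<lambda>y \<omega>. neg_log (enn2real (cond_mass y \<omega>)) * cond_mass y \<omega>"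
  let ?R = "\<lambda>y \<omega>. neg_log (g y \<omega>) * cond_mass y \<omega>"
  have L: "cond_entropy M N W Y = (\<integral>\<^sup>+y. \<integral>\<^sup>+\<omega>. ?L y \<omega> \<partial>M \<partial>count_space UNIV)"
    unfolding cond_entropy_eq by (rule nn_integral_target) measurable
  have R: "log_loss M W Y f = (\<integral>\<^sup>+y. \<integral>\<^sup>+\<omega>. ?R y \<omega> \<partial>M \<partial>count_space UNIV)"
    unfolding log_loss_def g_def[symmetric] by (rule nn_integral_target) measurable
  have C1: "(\<integral>\<^sup>+y. \<integral>\<^sup>+\<omega>. cond_mass y \<omega> \<partial>M \<partial>count_space UNIV) = 1"
    using nn_integral_target[of "\<lambda>_ _. 1"] by (simp add: emeasure_space_1)
  have "(\<integral>\<^sup>+y. \<integral>\<^sup>+\<omega>. ennreal (g y \<omega>) \<partial>M \<partial>count_space UNIV)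
      = (\<integral>\<^sup>+\<omega>. \<integral>\<^sup>+y. ennreal (g y \<omega>) \<partial>count_space UNIV \<partial>M)"
    by (rule nn_integral_count_space_nn_integral[symmetric]) auto
  also have "\<dots> = 1"
    by (simp add: g_def nn_integral_pmf emeasure_space_1)
  finally have g1: "(\<integral>\<^sup>+y. \<integral>\<^sup>+\<omega>. ennreal (g y \<omega>) \<partial>M \<partial>count_space UNIV) = 1" .
  have le: "(\<integral>\<^sup>+\<omega>. ?L y \<omega> \<partial>M) + (\<integral>\<^sup>+\<omega>. cond_mass y \<omega> \<partial>M)
      \<le> (\<integral>\<^sup>+\<omega>. ?R y \<omega> \<partial>M) + (\<integral>\<^sup>+\<omega>. ennreal (g y \<omega>) \<partial>M)" for y
  proof -
    have "(\<integral>\<^sup>+\<omega>. ?L y \<omega> + cond_mass y \<omega> \<partial>M) \<le> (\<integral>\<^sup>+\<omega>. ?R y \<omega> + ennreal (g y \<omega>) \<partial>M)"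
    proof (rule nn_integral_mono_AE, use AE_sum_cond_mass in eventually_elim)
      case (elim \<omega>)
      \<comment> \<open>Almost surely the masses sum to 1, so each is a finite number in the range
        of the pointwise inequality.\<close>
      obtain p where p: "0 \<le> p" "cond_mass y \<omega> = ennreal p" "p \<le> 1"
        using cond_mass_le_1[OF elim, of y] by (cases "cond_mass y \<omega>") (auto simp: top_unique)
      then show ?case
        using neg_log_cross_term[of p "g y \<omega>"]
        by (simp add: g_def pmf_le_1 mult.commute)
    qed
    then show ?thesis by (simp add: nn_integral_add)
  qed
  have "cond_entropy M N W Y + 1
      = (\<integral>\<^sup>+y. (\<integral>\<^sup>+\<omega>. ?L y \<omega> \<partial>M) + (\<integral>\<^sup>+\<omega>. cond_mass y \<omega> \<partial>M) \<partial>count_space UNIV)"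
    unfolding L C1[symmetric] by (rule nn_integral_add[symmetric]) auto
  also have "\<dots> \<le> (\<integral>\<^sup>+y. (\<integral>\<^sup>+\<omega>. ?R y \<omega> \<partial>M) + (\<integral>\<^sup>+\<omega>. ennreal (g y \<omega>) \<partial>M) \<partial>count_space UNIV)"
    by (intro nn_integral_mono le)
  also have "\<dots> = log_loss M W Y f + 1"
    unfolding R g1[symmetric] by (rule nn_integral_add) auto
  \<comment> \<open>The summand 1 is finite, so it cancels even if the loss or the entropy is
    infinite.\<close>
  finally show ?thesis by simp
qed

text \<open>The conditional masses are functions of the observed value by the Doob-Dynkin
  factorization; assembled into a distribution on the target they form a predictor whose loss is the
  entropy.\<close>

lemma predictor_cond_entropy:
  "\<exists>f. predictor N f \<and> log_loss M W Y f = cond_entropy M N W Y"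
proof -
  have "\<exists>h\<in>borel_measurable N. \<forall>\<omega>\<in>space M. cond_mass y \<omega> = h (W \<omega>)" for y
    by (rule Doob_Dynkin_ennreal[OF W_space])
      (use measurable_cond_mass_obs in \<open>simp add: obs_algebra_def\<close>)
  then obtain h where h [measurable]: "\<And>y. h y \<in> borel_measurable N"
    and hW: "\<And>y \<omega>. \<omega> \<in> space M \<Longrightarrow> cond_mass y \<omega> = h y (W \<omega>)" by metis
  \<comment> \<open>The factors \<open>h y\<close> are known to sum to 1 only at almost every
    observed value. Elsewhere an arbitrary point mass keeps \<open>f\<close> a distribution, and the
    set of good values must be measurable for \<open>f\<close> to be a predictor.\<close>
  define ok where "ok w \<longleftrightarrow> (\<integral>\<^sup>+y. h y w \<partial>count_space UNIV) = 1" for w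
  define f where "f w = (if ok w then embed_pmf (\<lambda>y. enn2real (h y w)) else return_pmf undefined)" for w
  have pmf_f: "pmf (f w) y = enn2real (h y w)" if "ok w" for w y
  proof -
    have "h y w \<le> 1" for y
      using nn_integral_ge_point[of y UNIV "\<lambda>y. h y w"] that by (simp add: ok_def)
    then have "ennreal (enn2real (h y w)) = h y w" for y
      by (meson ennreal_enn2real ennreal_one_less_top order_le_less_trans)
    then show ?thesis
      using that unfolding f_def by (simp add: pmf_embed_pmf ok_def)
  qed
  have [measurable]: "Measurable.pred N ok"
  proof -
    have [measurable]: "(\<lambda>w. \<integral>\<^sup>+y. h y w \<partial>count_space UNIV) \<in> borel_measurable N"
      by (rule measurable_nn_integral_count_space) measurable
    show ?thesis unfolding ok_def by measurable
  qed
  have "predictor N f" unfolding predictor_iff_pmf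
  proof
    fix y
    have "(\<lambda>w. pmf (f w) y) = (\<lambda>w. if ok w then enn2real (h y w) else pmf (return_pmf undefined) y)"
      using pmf_f by (auto simp: f_def)
    also have "\<dots> \<in> borel_measurable N" by measurable
    finally show "(\<lambda>w. pmf (f w) y) \<in> borel_measurable N" .
  qed
  moreover have "log_loss M W Y f = cond_entropy M N W Y"
    unfolding log_loss_def cond_entropy_eq
  proof (rule nn_integral_cong_AE, use AE_sum_cond_mass AE_space in eventually_elim)
    case (elim \<omega>)
    then have "ok (W \<omega>)" by (simp add: ok_def hW)
    with elim show ?case by (simp add: pmf_f hW)
  qed
  ultimately show ?thesis by blast
qed

text \<open>An optimal predictor for the coarse observation, precomposed with \<open>g\<close>, is
  an admissible predictor for the fine one with the same loss, so the fine entropy cannot exceed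
  it.\<close>

lemma cond_entropy_coarser:
  assumes g: "g \<in> N \<rightarrow>\<^sub>M N'"
  shows "cond_entropy M N W Y \<le> cond_entropy M N' (\<lambda>\<omega>. g (W \<omega>)) Y"
proof -
  interpret coarse: observed_target M N' "\<lambda>\<omega>. g (W \<omega>)" Y
    by unfold_locales (use g in measurable)
  obtain f where f: "predictor N' f"
    "log_loss M (\<lambda>\<omega>. g (W \<omega>)) Y f = cond_entropy M N' (\<lambda>\<omega>. g (W \<omega>)) Y"
    using coarse.predictor_cond_entropy by blast
  have "cond_entropy M N W Y \<le> log_loss M W Y (\<lambda>p. f (g p))"
    by (intro cond_entropy_le_log_loss predictor_compose[OF g] f(1))
  also have "\<dots> = cond_entropy M N' (\<lambda>\<omega>. g (W \<omega>)) Y"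
    unfolding f(2)[symmetric] by (simp add: log_loss_def)
  finally show ?thesis .
qed

end

section \<open>Orbit-constant predictors as predictors on the quotient\<close>

text \<open>\<open>orbit_constant_iff_factors\<close> is applied to the predictive laws as measures,
  where measurability lives; the factor on the quotient then has to be turned back into a
  \<open>pmf\<close>-valued map.\<close>

lemma predictor_orbit_constant_iff:
  assumes \<phi>: "\<And>v. v \<in> {1..K} \<Longrightarrow> \<phi> v \<in> S \<rightarrow>\<^sub>M V"
  defines "r \<equiv> view_rel S V K \<phi>"
  shows "predictor V f \<and> orbit_constant S K \<phi> f \<longleftrightarrow>
    predictor V f \<and> (\<exists>g. predictor (quot_space V r) g \<and> (\<forall>p\<in>space V. f p = g (quot_map r p)))"
proof (rule conj_cong[OF refl])
  let ?P = "prob_algebra (count_space UNIV)"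
  assume "predictor V f"
  then have f: "(\<lambda>p. measure_pmf (f p)) \<in> V \<rightarrow>\<^sub>M ?P" by (simp add: predictor_def)
  have "orbit_constant S K \<phi> f \<longleftrightarrow> orbit_constant S K \<phi> (\<lambda>p. measure_pmf (f p))"
    by (simp add: orbit_constant_def measure_pmf_inject)
  also have "\<dots> \<longleftrightarrow> (\<exists>g \<in> quot_space V r \<rightarrow>\<^sub>M ?P. \<forall>p\<in>space V. measure_pmf (f p) = g (quot_map r p))"
    unfolding r_def by (rule orbit_constant_iff_factors[OF \<phi> f])
  also have "\<dots> \<longleftrightarrow> (\<exists>g. predictor (quot_space V r) g \<and> (\<forall>p\<in>space V. f p = g (quot_map r p)))"
  proof
    assume "\<exists>g \<in> quot_space V r \<rightarrow>\<^sub>M ?P. \<forall>p\<in>space V. measure_pmf (f p) = g (quot_map r p)"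
    then obtain g where g: "g \<in> quot_space V r \<rightarrow>\<^sub>M ?P"
      and fg: "\<And>p. p \<in> space V \<Longrightarrow> measure_pmf (f p) = g (quot_map r p)" by blast
    have inv: "Abs_pmf (g (quot_map r p)) = f p" if "p \<in> space V" for p
      using fg[OF that] by (metis measure_pmf_inverse)
    \<comment> \<open>Every point of the quotient is the class of some \<open>p\<close>, so
      \<open>g B\<close> is the law of \<open>f p\<close>, and \<open>Abs_pmf\<close> loses nothing
      there.\<close>
    have "measure_pmf (Abs_pmf (g B)) = g B" if "B \<in> space (quot_space V r)" for B
    proof -
      obtain p where "p \<in> space V" "B = quot_map r p"
        using \<open>B \<in> _\<close> by (auto simp: quot_map_def elim!: quotientE)
      then show ?thesis using inv fg by simp
    qed
    then have "predictor (quot_space V r) (\<lambda>B. Abs_pmf (g B))"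
      unfolding predictor_def using g by (subst measurable_cong) auto
    with inv show "\<exists>g. predictor (quot_space V r) g \<and> (\<forall>p\<in>space V. f p = g (quot_map r p))"
      by (intro exI[of _ "\<lambda>B. Abs_pmf (g B)"]) simp
  next
    assume "\<exists>g. predictor (quot_space V r) g \<and> (\<forall>p\<in>space V. f p = g (quot_map r p))"
    then show "\<exists>g \<in> quot_space V r \<rightarrow>\<^sub>M ?P. \<forall>p\<in>space V. measure_pmf (f p) = g (quot_map r p)"
      unfolding predictor_def by auto
  qed
  finally show "orbit_constant S K \<phi> f \<longleftrightarrow>
    (\<exists>g. predictor (quot_space V r) g \<and> (\<forall>p\<in>space V. f p = g (quot_map r p)))" .
qed

section \<open>The invariant risk against the risks of single views\<close>

theorem theorem2:
  fixes M :: "'a measure" and S :: "'x measure" and V :: "'v measure"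
    and X :: "'a \<Rightarrow> 'x" and Y :: "'a \<Rightarrow> 'y::countable"
    and K :: nat and \<phi> :: "nat \<Rightarrow> 'x \<Rightarrow> 'v"
  assumes "prob_space M"
    and "X \<in> M \<rightarrow>\<^sub>M S"
    and "Y \<in> M \<rightarrow>\<^sub>M count_space UNIV"
    and "1 \<le> K"
    and "\<And>v. v \<in> {1..K} \<Longrightarrow> \<phi> v \<in> S \<rightarrow>\<^sub>M V"
  shows "let q = quot_map (view_rel S V K \<phi>);
             Q = (\<lambda>\<omega>. q (\<phi> 1 (X \<omega>)));
             R = view_risk M V \<phi> X Y;
             R_inv = inv_risk M S V K \<phi> X Y;
             \<delta> = enn2ereal (Max (R ` {1..K})) - enn2ereal (Min (R ` {1..K}))
         in (\<forall>v\<in>{1..K}. \<forall>\<omega>\<in>space M. q (\<phi> v (X \<omega>)) = Q \<omega>) \<and>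
            R_inv = cond_entropy M (quot_space V (view_rel S V K \<phi>)) Q Y \<and>
            R_inv \<ge> Max (R ` {1..K}) \<and>
            enn2ereal R_inv - enn2ereal (Min (R ` {1..K})) \<ge> \<delta>"
proof -
  define r where "r = view_rel S V K \<phi>"
  define q where "q = quot_map r"
  define Q where "Q \<omega> = q (\<phi> 1 (X \<omega>))" for \<omega>
  define R where "R = view_risk M V \<phi> X Y"
  define R_inv where "R_inv = inv_risk M S V K \<phi> X Y"
  have \<phi>X: "(\<lambda>\<omega>. \<phi> v (X \<omega>)) \<in> M \<rightarrow>\<^sub>M V" if "v \<in> {1..K}" for v
    using assms(2) assms(5)[OF that] by (rule measurable_compose)
  have one: "1 \<in> {1..K}" using assms(4) by simp
  have r: "equiv (space V) r" unfolding r_def using assms(5) by (rule equiv_view_rel)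
  have q: "q \<in> V \<rightarrow>\<^sub>M quot_space V r" unfolding q_def using r by (rule measurable_quot_map)
  have qQ: "q (\<phi> v (X \<omega>)) = Q \<omega>" if "v \<in> {1..K}" "\<omega> \<in> space M" for v \<omega>
    unfolding q_def Q_def r_def
    by (rule quot_map_view_eq[OF assms(5) measurable_space[OF assms(2) that(2)] that(1) one])
  have obs: "observed_target M V (\<lambda>\<omega>. \<phi> v (X \<omega>)) Y" if "v \<in> {1..K}" for v
    using assms(1,3) \<phi>X[OF that] by (simp add: observed_target_def observed_target_axioms_def)
  interpret quot: observed_target M "quot_space V r" Q Y
    using assms(1,3) measurable_compose[OF \<phi>X[OF one] q]
    by (simp add: observed_target_def observed_target_axioms_def Q_def[abs_def])
  have orbit_iff: "predictor V f \<and> orbit_constant S K \<phi> f \<longleftrightarrow>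
      predictor V f \<and> (\<exists>g. predictor (quot_space V r) g \<and> (\<forall>p\<in>space V. f p = g (q p)))"
    for f :: "'v \<Rightarrow> 'y pmf"
    unfolding q_def r_def by (rule predictor_orbit_constant_iff) (rule assms(5))
  have loss_eq: "log_loss M (\<lambda>\<omega>. \<phi> 1 (X \<omega>)) Y f = log_loss M Q Y g"
    if "\<And>p. p \<in> space V \<Longrightarrow> f p = g (q p)" for f g
    unfolding log_loss_def Q_def
    by (intro nn_integral_cong) (simp only: that measurable_space[OF \<phi>X[OF one]])
  have R_inv: "R_inv = cond_entropy M (quot_space V r) Q Y"
  proof (rule antisym)
    \<comment> \<open>Upper bound: the optimal predictor on the quotient, pulled back along
      \<open>q\<close>, competes in the infimum.\<close>
    obtain g where g: "predictor (quot_space V r) g"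
      "log_loss M Q Y g = cond_entropy M (quot_space V r) Q Y"
      using quot.predictor_cond_entropy by blast
    have "predictor V (\<lambda>p. g (q p)) \<and> orbit_constant S K \<phi> (\<lambda>p. g (q p))"
      unfolding orbit_iff using predictor_compose[OF q g(1)] g(1) by blast
    then have "R_inv \<le> log_loss M (\<lambda>\<omega>. \<phi> 1 (X \<omega>)) Y (\<lambda>p. g (q p))"
      unfolding R_inv_def inv_risk_def by (intro INF_lower) simp
    with g(2) loss_eq show "R_inv \<le> cond_entropy M (quot_space V r) Q Y" by metis
  next
    \<comment> \<open>Lower bound: each competing predictor factors through \<open>q\<close>, and
      Gibbs' inequality applies to its factor.\<close>
    show "cond_entropy M (quot_space V r) Q Y \<le> R_inv"
      unfolding R_inv_def inv_risk_def
    proof (rule INF_greatest)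
      fix f :: "'v \<Rightarrow> 'y pmf"
      assume "f \<in> {f. predictor V f \<and> orbit_constant S K \<phi> f}"
      then obtain g where "predictor (quot_space V r) g" "\<And>p. p \<in> space V \<Longrightarrow> f p = g (q p)"
        using orbit_iff[of f] by auto
      then show "cond_entropy M (quot_space V r) Q Y \<le> log_loss M (\<lambda>\<omega>. \<phi> 1 (X \<omega>)) Y f"
        using quot.cond_entropy_le_log_loss loss_eq by metis
    qed
  qed
  have R_le: "R v \<le> R_inv" if v: "v \<in> {1..K}" for v
  proof -
    have "R v \<le> cond_entropy M (quot_space V r) (\<lambda>\<omega>. q (\<phi> v (X \<omega>))) Y"
      unfolding R_def view_risk_def
      by (rule observed_target.cond_entropy_coarser[OF obs[OF v] q])
    \<comment> \<open>On \<open>space M\<close> the class of view \<open>v\<close> agrees with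
      \<open>Q\<close>, so both generate the same algebra and give the same entropy.\<close>
    also have "\<dots> = R_inv"
      unfolding R_inv cond_entropy_def cond_prob_mass_def using qQ[OF v]
      by (simp cong: vimage_algebra_cong)
    finally show ?thesis .
  qed
  have Max: "Max (R ` {1..K}) \<le> R_inv"
    using R_le one by (subst Max_le_iff) auto
  \<comment> \<open>The differences are taken in \<open>ereal\<close>, where subtraction is monotone
    in its first argument also at infinite values.\<close>
  then have "enn2ereal (Max (R ` {1..K})) - enn2ereal (Min (R ` {1..K}))
      \<le> enn2ereal R_inv - enn2ereal (Min (R ` {1..K}))"
    by (intro ereal_minus_mono) (simp_all add: less_eq_ennreal.rep_eq)
  with qQ R_inv Max show ?thesis
    unfolding Let_def r_def[symmetric] q_def[symmetric] R_def[symmetric] R_inv_def[symmetric] Q_def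
    by blast
qed

end
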